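(* Let $R$ be a real number with $0<R<1$, and let $p_1<p_2<p_3<\cdots$ be an infinite increasing sequence of primes such that $(p_1-1)R\ge 1$. For each $i\ge 1$ put $r_i=\lfloor (p_i-1)R\rfloor$. Then for each $i\ge1$ there exists an MDS $(p_i-1,r_i)$ code $\mathcal{C}_i$ over the prime field $GF(p_i)=\mathbb{Z}_{p_i}$, and its minimum distance $d_i=(p_i-1)-r_i+1$ satisfies $$\lim_{i\to\infty}\frac{d_i}{p_i-1}=1-R.$$
   Context: $GF(q)$ denotes the finite field of order $q$. An $(n,r)$ linear code over a field $\mathbb{F}$ is an $r$-dimensional linear subspace of $\mathbb{F}^n$. Its (minimum) distance $d$ is the minimum Hamming weight of a nonzero codeword. The code is MDS (maximum distance separable) if $d=n-r+1$. *)

theory Defs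
  imports Complex_Main "HOL-Number_Theory.Residues" "Jordan_Normal_Form.Missing_VectorSpace"
begin

text \<open>The ambient space of words of length \<open>n\<close> over \<open>K\<close> consists of the extensional functions
  from \<open>{..<n}\<close> to the carrier of \<open>K\<close>, with pointwise operations. The locale predicate
  \<^const>\<open>VectorSpace.subspace\<close> used below includes that \<open>K\<close> is a field.\<close>

abbreviation word_space :: "('a, 'b) ring_scheme \<Rightarrow> nat \<Rightarrow> ('a, nat \<Rightarrow> 'a) module" where
  "word_space K n \<equiv> ring.func_space K {..<n}"

definition linear_code :: "('a, 'b) ring_scheme \<Rightarrow> nat \<Rightarrow> nat \<Rightarrow> (nat \<Rightarrow> 'a) set \<Rightarrow> bool" where
  "linear_code K n r C \<longleftrightarrow>
     VectorSpace.subspace K C (word_space K n) \<and>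
     vectorspace.dim K ((word_space K n)\<lparr>carrier := C\<rparr>) = r"

definition hamming_weight :: "('a, 'b) ring_scheme \<Rightarrow> nat \<Rightarrow> (nat \<Rightarrow> 'a) \<Rightarrow> nat" where
  "hamming_weight K n c = card {i \<in> {..<n}. c i \<noteq> \<zero>\<^bsub>K\<^esub>}"

text \<open>Only meaningful for codes with a nonzero codeword: otherwise it is the minimum of the
  empty set.\<close>

definition min_distance :: "('a, 'b) ring_scheme \<Rightarrow> nat \<Rightarrow> (nat \<Rightarrow> 'a) set \<Rightarrow> nat" where
  "min_distance K n C = Min (hamming_weight K n ` (C - {\<zero>\<^bsub>word_space K n\<^esub>}))"

definition MDS_code :: "('a, 'b) ring_scheme \<Rightarrow> nat \<Rightarrow> nat \<Rightarrow> (nat \<Rightarrow> 'a) set \<Rightarrow> bool" where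
  "MDS_code K n r C \<longleftrightarrow> linear_code K n r C \<and> min_distance K n C = n - r + 1"

abbreviation GF :: "nat \<Rightarrow> int ring" where
  "GF p \<equiv> residue_ring (int p)"

end

(* Reed-Solomon codes: the words of values, at n distinct points of GF(p), of the polynomials of
   degree less than r. Such a polynomial with r zeros among the points vanishes, so a nonzero
   codeword has weight at least n - r + 1. Lagrange interpolation at the first r points provides a
   basis with r elements, whose members have r - 1 zeros each, so the bound is attained. Finally
   d - (p - 1) (1 - R) = 1 + (p - 1) R - r lies in [1, 2). *)
theory Submission
  imports Defs "HOL-Computational_Algebra.Polynomial"
begin

section \<open>Integer polynomials modulo a prime: counting roots and interpolating\<close>

text \<open>Splitting off one root \<open>a\<close> lowers the degree; at any other point of
  \<open>A\<close>, \<open>q\<close> does not divide \<open>x - a\<close>, so by primality it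
  divides the quotient there, and induction applies. Working with integer polynomials and
  divisibility avoids a separate polynomial ring over the residue field.\<close>

lemma prime_dvd_poly_if_many_roots:
  fixes f :: "int poly" and q :: int
  assumes "prime q" and "finite A" and "degree f < card A"
    and "\<And>x. x \<in> A \<Longrightarrow> q dvd poly f x"
    and "\<And>x y. x \<in> A \<Longrightarrow> y \<in> A \<Longrightarrow> q dvd x - y \<Longrightarrow> x = y"
  shows "q dvd poly f z"
  using assms(2-5)
proof (induction "degree f" arbitrary: f A)
  case 0
  then obtain a where "a \<in> A"
    by fastforce
  moreover obtain c where "f = [:c:]"
    using 0(1) degree_eq_zeroE by metis
  ultimately show ?case
    using 0(4)[of a] by simp
next
  case (Suc d)
  then obtain a where a: "a \<in> A"
    by fastforce
  define g where "g = synthetic_div f a"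
  \<comment> \<open>Exact division over the integers: the remainder \<open>poly f a\<close> need not
    be zero, only a multiple of \<open>q\<close>.\<close>
  have f: "poly f x = (x - a) * poly g x + poly f a" for x
    using arg_cong[OF synthetic_div_correct'[of a f], of "\<lambda>h. poly h x"]
    by (simp add: g_def algebra_simps)
  have "q dvd poly g z"
  proof (rule Suc.hyps(1))
    show "d = degree g"
      using Suc.hyps(2) by (simp add: g_def degree_synthetic_div)
    show "degree g < card (A - {a})"
      using Suc.hyps(2) Suc.prems(1,2) a by (simp add: g_def degree_synthetic_div)
    show "q dvd poly g x" if "x \<in> A - {a}" for x
    proof -
      have "q dvd (x - a) * poly g x"
        using f[of x] Suc.prems(3)[of x] Suc.prems(3)[OF a] that
        by (metis DiffD1 dvd_add_left_iff)
      moreover have "\<not> q dvd x - a"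
        using Suc.prems(4)[of x a] a that by auto
      ultimately show ?thesis
        using \<open>prime q\<close> prime_dvd_mult_iff by blast
    qed
  qed (use Suc.prems in auto)
  then show ?case
    using f[of z] Suc.prems(3)[OF a] by simp
qed

lemma nat_eq_if_dvd_diff:
  fixes i j p :: nat
  assumes "int p dvd int i - int j" and "i < p" and "j < p"
  shows "i = j"
  using assms by (metis cong_def mod_less mod_eq_dvd_iff of_nat_mod of_nat_eq_iff)

text \<open>The product of the linear factors at the other points vanishes there, and its value at
  \<open>k\<close> is a unit modulo \<open>p\<close> because \<open>r \<le> p\<close> keeps the
  points distinct. Scaling by an inverse of that value replaces the division in Lagrange's
  formula.\<close>

lemma lagrange_polynomial_mod_prime:
  assumes "prime p" and "r \<le> p" and "k < r"
  shows "\<exists>L :: int poly. degree L < r \<and>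
    (\<forall>i<r. poly L (int i) mod int p = (if i = k then 1 else 0))"
proof -
  define Q :: "int poly" where "Q = (\<Prod>m\<in>{..<r} - {k}. [:- int m, 1:])"
  have "degree Q \<le> (\<Sum>m\<in>{..<r} - {k}. 1)"
    unfolding Q_def by (rule order_trans[OF degree_prod_sum_le]) auto
  then have deg: "degree Q < r"
    using \<open>k < r\<close> by simp
  have Q: "poly Q x = (\<Prod>m\<in>{..<r} - {k}. x - int m)" for x
    by (simp add: Q_def poly_prod)
  have "\<not> int p dvd poly Q (int k)"
  proof
    assume "int p dvd poly Q (int k)"
    then obtain m where "m < r" "m \<noteq> k" "int p dvd int k - int m"
      using \<open>prime p\<close> by (auto simp: Q prime_dvd_prod_iff)
    then show False
      using nat_eq_if_dvd_diff[of p k m] assms by auto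
  qed
  then have "coprime (poly Q (int k)) (int p)"
    using \<open>prime p\<close> by (metis coprime_commute prime_imp_coprime prime_nat_int_transfer)
  then obtain u where u: "[poly Q (int k) * u = 1] (mod int p)"
    using cong_solve_coprime_int by blast
  have "poly (smult u Q) (int i) mod int p = (if i = k then 1 else 0)" if "i < r" for i
  proof (cases "i = k")
    case True
    then show ?thesis
      using u prime_gt_1_nat[OF \<open>prime p\<close>] by (simp add: cong_def mult.commute)
  next
    case False
    then have "poly Q (int i) = 0"
      using that by (auto simp: Q)
    then show ?thesis
      using False by simp
  qed
  moreover have "degree (smult u Q) < r"
    using deg by (rule le_less_trans[OF degree_smult_le])
  ultimately show ?thesis
    by blast
qed

section \<open>Reed-Solomon codes over a prime field\<close>

context residues_prime
begin

lemma vectorspace_word_space: "vectorspace R (word_space R n)"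
  unfolding vectorspace_def using func_space_is_module is_field by blast

lemma carrier_word_space: "carrier (word_space R n) = {..<n} \<rightarrow>\<^sub>E {0..int p - 1}"
  by (simp add: func_space_def res_carrier_eq)

lemma zero_word_space: "\<zero>\<^bsub>word_space R n\<^esub> = (\<lambda>i\<in>{..<n}. 0)"
  by (simp add: func_space_def res_zero_eq)

text \<open>Turns the abstract linear combination into an ordinary integer sum with a single
  reduction at the end, so that later steps are integer arithmetic.\<close>

lemma lincomb_word_space:
  assumes "finite A" and "A \<subseteq> carrier (word_space R n)" and "a \<in> A \<rightarrow> carrier R" and "i < n"
  shows "module.lincomb (word_space R n) a A i = (\<Sum>v\<in>A. a v * v i) mod int p"
proof -
  interpret V: vectorspace R "word_space R n"
    by (rule vectorspace_word_space)
  show ?thesis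
    using assms(1-3)
  proof (induction A rule: finite_induct)
    case empty
    then show ?case
      using \<open>i < n\<close> by (simp add: V.lincomb_def zero_word_space)
  next
    case (insert v A)
    then have "V.module.lincomb a (insert v A) =
        a v \<odot>\<^bsub>word_space R n\<^esub> v \<oplus>\<^bsub>word_space R n\<^esub> V.module.lincomb a A"
      by (intro V.lincomb_insert2) auto
    then show ?case
      using insert \<open>i < n\<close>
      by (simp add: func_space_def res_add_eq res_mult_eq mod_simps)
  qed
qed

text \<open>The evaluation points are \<open>0, ..., n - 1\<close>, distinct modulo \<open>p\<close>
  since \<open>n \<le> p\<close>. The code is taken as the span of the Lagrange words, so that
  linearity and dimension come from the basis; of the polynomial description only one inclusion,
  \<open>poly_C\<close>, is needed.\<close>

lemma reed_solomon_MDS: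
  assumes "0 < r" and "r \<le> n" and "n \<le> p"
  shows "\<exists>C. MDS_code R n r C"
proof -
  let ?V = "word_space R n"
  interpret V: vectorspace R ?V
    by (rule vectorspace_word_space)
  obtain L :: "nat \<Rightarrow> int poly" where deg: "\<And>k. k < r \<Longrightarrow> degree (L k) < r"
    and L: "\<And>k i. k < r \<Longrightarrow> i < r \<Longrightarrow> poly (L k) (int i) mod int p = (if i = k then 1 else 0)"
    using lagrange_polynomial_mod_prime[OF p_prime, of r] assms by (metis order_trans)
  define b where "b k = (\<lambda>i\<in>{..<n}. poly (L k) (int i) mod int p)" for k
  define B where "B = b ` {..<r}"
  define C where "C = V.span B"
  have b_delta: "b k i = (if i = k then 1 else 0)" if "k < r" "i < r" for k i
    using that L assms by (simp add: b_def)
  have inj: "inj_on b {..<r}"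
    by (intro inj_onI) (metis b_delta lessThan_iff zero_neq_one)
  have finB: "finite B" and cardB: "card B = r"
    using inj by (simp_all add: B_def card_image)
  have BV: "B \<subseteq> carrier ?V"
    using prime_gt_0_nat[OF p_prime] by (auto simp: B_def b_def carrier_word_space split: if_splits)
  have lc: "V.module.lincomb a B i = (\<Sum>k<r. a (b k) * b k i) mod int p"
    if "a \<in> B \<rightarrow> carrier R" "i < n" for a i
    using lincomb_word_space[OF finB BV that] inj by (simp add: B_def sum.reindex)
  \<comment> \<open>On the first \<open>r\<close> coordinates the words \<open>b k\<close> are unit
    vectors, so these coordinates read off the coefficients; this yields independence.\<close>
  have lc_coord: "V.module.lincomb a B j = a (b j)" if "a \<in> B \<rightarrow> carrier R" "j < r" for a j
  proof -
    have "(\<Sum>k<r. a (b k) * b k j) = (\<Sum>k<r. if k = j then a (b j) else 0)"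
      using that by (intro sum.cong) (auto simp: b_delta)
    moreover have "a (b j) \<in> {0..int p - 1}"
      using that by (auto simp: B_def res_carrier_eq)
    ultimately show ?thesis
      using lc[OF that(1), of j] that assms by simp
  qed
  have li: "V.lin_indpt B"
  proof (rule V.finite_lin_indpt2[OF finB BV], rule ballI)
    fix a v assume "a \<in> B \<rightarrow> carrier R" and "V.module.lincomb a B = \<zero>\<^bsub>?V\<^esub>" and "v \<in> B"
    then show "a v = \<zero>"
      using lc_coord[of a] assms by (auto simp: B_def zero_word_space res_zero_eq)
  qed
  have sub: "subspace R C ?V"
    unfolding C_def by (rule V.span_is_subspace[OF BV])
  then interpret C: vectorspace R "?V\<lparr>carrier := C\<rparr>"
    by (rule V.subspace_is_vs)
  have BC: "B \<subseteq> C"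
    unfolding C_def by (rule V.in_own_span[OF BV])
  have "C.basis B"
    using V.span_li_not_depend[OF BC] sub li BC
    by (simp add: C.basis_def flip: C_def)
  then have "linear_code R n r C"
    using sub C.dim_basis[OF finB] cardB by (simp add: linear_code_def)
  have poly_C: "\<exists>f. degree f < r \<and> (\<forall>i<n. c i = poly f (int i) mod int p)" if "c \<in> C" for c
  proof -
    obtain a where a: "a \<in> B \<rightarrow> carrier R" and c: "c = V.module.lincomb a B"
      using \<open>c \<in> C\<close> unfolding C_def V.finite_span[OF finB BV] by blast
    \<comment> \<open>The same combination, taken of the polynomials instead of their reduced
      values.\<close>
    define f where "f = (\<Sum>k<r. smult (a (b k)) (L k))"
    have "degree f < r"
      unfolding f_def using deg \<open>0 < r\<close>
      by (intro degree_sum_less) (auto intro: le_less_trans[OF degree_smult_le])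
    moreover have "c i = poly f (int i) mod int p" if "i < n" for i
    proof -
      have "c i = (\<Sum>k<r. a (b k) * (poly (L k) (int i) mod int p)) mod int p"
        using lc[OF a that] that by (simp add: c b_def)
      also have "\<dots> = (\<Sum>k<r. a (b k) * (poly (L k) (int i) mod int p) mod int p) mod int p"
        by (simp only: mod_sum_eq)
      also have "\<dots> = (\<Sum>k<r. a (b k) * poly (L k) (int i) mod int p) mod int p"
        by (simp only: mod_mult_right_eq)
      also have "\<dots> = poly f (int i) mod int p"
        by (simp add: f_def poly_sum mod_sum_eq)
      finally show ?thesis .
    qed
    ultimately show ?thesis
      by blast
  qed
  have weight: "hamming_weight R n c = n - card {i. i < n \<and> c i = 0}" for c
  proof -
    have "{i \<in> {..<n}. c i \<noteq> \<zero>} = {..<n} - {i. i < n \<and> c i = 0}"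
      by (auto simp: res_zero_eq)
    then show ?thesis
      by (simp add: hamming_weight_def card_Diff_subset subset_iff)
  qed
  have weight_ge: "n - r + 1 \<le> hamming_weight R n c" if "c \<in> C" "c \<noteq> \<zero>\<^bsub>?V\<^esub>" for c
  proof -
    obtain f where f: "degree f < r" "\<And>i. i < n \<Longrightarrow> c i = poly f (int i) mod int p"
      using poly_C[OF \<open>c \<in> C\<close>] by blast
    let ?Z = "{i. i < n \<and> c i = 0}"
    have "card ?Z < r"
    proof (rule ccontr)
      assume "\<not> card ?Z < r"
      then have deg_f: "degree f < card (int ` ?Z)"
        using f(1) by (simp add: card_image)
      have "int p dvd poly f z" for z
      proof (rule prime_dvd_poly_if_many_roots[of "int p" "int ` ?Z"])
        show "int p dvd poly f x" if "x \<in> int ` ?Z" for x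
        proof -
          obtain i where "i < n" "c i = 0" "x = int i"
            using \<open>x \<in> int ` ?Z\<close> by auto
          then show ?thesis
            using f(2)[of i] by (simp add: mod_eq_0_iff_dvd)
        qed
        show "degree f < card (int ` ?Z)"
          by (rule deg_f)
        show "x = y" if "x \<in> int ` ?Z" "y \<in> int ` ?Z" "int p dvd x - y" for x y
        proof -
          obtain i j where "i < n" "j < n" "x = int i" "y = int j"
            using \<open>x \<in> int ` ?Z\<close> \<open>y \<in> int ` ?Z\<close> by auto
          then show ?thesis
            using nat_eq_if_dvd_diff[of p i j] \<open>int p dvd x - y\<close> \<open>n \<le> p\<close> by simp
        qed
      qed (use p_prime in simp_all)
      \<comment> \<open>All \<open>n\<close> coordinates vanish; extensionality of words settles the
        arguments outside \<open>{..<n}\<close>.\<close>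
      then have "c i = 0" if "i < n" for i
        using f(2)[OF that] by simp
      moreover have "c \<in> carrier ?V"
        using \<open>c \<in> C\<close> BV by (simp add: C_def)
      ultimately have "c = \<zero>\<^bsub>?V\<^esub>"
        by (intro ext) (auto simp: zero_word_space carrier_word_space PiE_def extensional_def)
      with \<open>c \<noteq> \<zero>\<^bsub>?V\<^esub>\<close> show False
        by simp
    qed
    then show ?thesis
      using \<open>r \<le> n\<close> by (simp add: weight)
  qed
  have "b 0 \<in> C"
    using BC \<open>0 < r\<close> by (auto simp: B_def)
  moreover have "b 0 \<noteq> \<zero>\<^bsub>?V\<^esub>"
    using b_delta[of 0 0] assms by (auto simp: zero_word_space)
  \<comment> \<open>The word \<open>b 0\<close> vanishes at \<open>1, ..., r - 1\<close>, so it
    attains the bound.\<close>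
  moreover have "hamming_weight R n (b 0) \<le> n - r + 1"
  proof -
    have "card {1..<r} \<le> card {i. i < n \<and> b 0 i = 0}"
      using b_delta[of 0] assms by (intro card_mono) auto
    then show ?thesis
      using assms by (simp add: weight)
  qed
  ultimately have "n - r + 1 \<in> hamming_weight R n ` (C - {\<zero>\<^bsub>?V\<^esub>})"
    using weight_ge[of "b 0"] by (intro image_eqI[of _ _ "b 0"]) auto
  \<comment> \<open>\<open>Min\<close> requires a finite set; bounding the weights by
    \<open>n\<close> suffices, without finiteness of \<open>C\<close>.\<close>
  moreover have "finite (hamming_weight R n ` (C - {\<zero>\<^bsub>?V\<^esub>}))"
    by (rule finite_subset[of _ "{..n}"]) (auto simp: weight)
  ultimately have "min_distance R n C = n - r + 1"
    unfolding min_distance_def using weight_ge by (intro Min_eqI) auto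
  with \<open>linear_code R n r C\<close> show ?thesis
    by (auto simp: MDS_code_def)
qed

end

section \<open>Asymptotics of the relative distance\<close>

text \<open>Provides an explicit rate at which \<open>p i\<close> tends to infinity, for the error
  term in the limit.\<close>

lemma strict_mono_on_primes_gt_index:
  fixes p :: "nat \<Rightarrow> nat"
  assumes "strict_mono_on {1..} p" and "prime (p 1)" and "i \<ge> 1"
  shows "i < p i"
  using \<open>i \<ge> 1\<close>
proof (induction i rule: dec_induct)
  case base
  then show ?case
    using prime_gt_1_nat[OF assms(2)] by simp
next
  case (step i)
  then show ?case
    using strict_mono_onD[OF assms(1), of i "Suc i"] by simp
qed

text \<open>The limit is claimed for every choice of MDS codes \<open>C i\<close>, since the
  distance depends only on \<open>p i\<close> and \<open>r i\<close>.\<close>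

theorem mainTheorem6:
  fixes R :: real and p r :: "nat \<Rightarrow> nat"
  assumes "0 < R" and "R < 1"
    and "strict_mono_on {1..} p"
    and "\<And>i. i \<ge> 1 \<Longrightarrow> prime (p i)"
    and "(real (p 1) - 1) * R \<ge> 1"
    and "\<And>i. i \<ge> 1 \<Longrightarrow> r i = nat \<lfloor>(real (p i) - 1) * R\<rfloor>"
  shows "(\<forall>i\<ge>1. \<exists>C. MDS_code (GF (p i)) (p i - 1) (r i) C) \<and>
    (\<forall>C. (\<forall>i\<ge>1. MDS_code (GF (p i)) (p i - 1) (r i) (C i)) \<longrightarrow>
      (\<forall>i\<ge>1. min_distance (GF (p i)) (p i - 1) (C i) = (p i - 1) - r i + 1) \<and>
      (\<lambda>i. real (min_distance (GF (p i)) (p i - 1) (C i)) / (real (p i) - 1))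
        \<longlonglongrightarrow> 1 - R)"
proof -
  have p_gt: "i < p i" if "i \<ge> 1" for i
    using strict_mono_on_primes_gt_index[OF assms(3) assms(4)[of 1]] that by simp
  \<comment> \<open>Carries the hypothesis on \<open>p 1\<close> to all indices; it makes
    \<open>r i\<close> positive, so that the codes have nonzero words.\<close>
  have ge1: "(real (p i) - 1) * R \<ge> 1" if "i \<ge> 1" for i
  proof -
    have "p 1 \<le> p i"
      using strict_mono_on_leD[OF assms(3), of 1 i] that by simp
    then have "(real (p 1) - 1) * R \<le> (real (p i) - 1) * R"
      using \<open>0 < R\<close> by (intro mult_right_mono) auto
    then show ?thesis
      using assms(5) by simp
  qed
  have r_pos: "0 < r i" if "i \<ge> 1" for i
    using ge1[OF that] assms(6)[OF that] by (simp add: le_floor_iff)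
  have r_le: "real (r i) \<le> (real (p i) - 1) * R" if "i \<ge> 1" for i
    using ge1[OF that] assms(6)[OF that] by simp
  have r_gt: "(real (p i) - 1) * R < real (r i) + 1" if "i \<ge> 1" for i
    using ge1[OF that] assms(6)[OF that] by linarith
  have r_le_n: "r i \<le> p i - 1" if "i \<ge> 1" for i
  proof -
    have "(real (p i) - 1) * R \<le> real (p i) - 1"
      using p_gt[OF that] \<open>R < 1\<close> by (intro mult_left_le) auto
    then have "real (r i) \<le> real (p i) - 1"
      using r_le[OF that] by linarith
    then show ?thesis
      by linarith
  qed
  have "\<exists>C. MDS_code (GF (p i)) (p i - 1) (r i) C" if "i \<ge> 1" for i
  proof -
    interpret residues_prime "p i" "GF (p i)"
      using assms(4)[OF that] by unfold_locales simp_all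
    show ?thesis
      using r_pos[OF that] r_le_n[OF that] by (intro reed_solomon_MDS) auto
  qed
  moreover have "(\<lambda>i. real (min_distance (GF (p i)) (p i - 1) (C i)) / (real (p i) - 1))
      \<longlonglongrightarrow> 1 - R"
    if C: "\<forall>i\<ge>1. min_distance (GF (p i)) (p i - 1) (C i) = (p i - 1) - r i + 1" for C
  proof -
    \<comment> \<open>The excess over \<open>1 - R\<close> is below \<open>2 / N\<close> with
      \<open>N = p i - 1\<close>; since \<open>i \<le> N\<close>, it is relaxed to the null sequence
      \<open>2 / real i\<close>.\<close>
    have bounds: "1 - R \<le> real (min_distance (GF (p i)) (p i - 1) (C i)) / (real (p i) - 1) \<and>
        real (min_distance (GF (p i)) (p i - 1) (C i)) / (real (p i) - 1) \<le> 1 - R + 2 / real i"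
      if "i \<ge> 1" for i
    proof -
      define N where "N = real (p i) - 1"
      \<comment> \<open>Truncated subtraction agrees with real subtraction here because
        \<open>r i \<le> p i - 1\<close>.\<close>
      have d: "real (min_distance (GF (p i)) (p i - 1) (C i)) = N - real (r i) + 1"
        using C r_le_n[OF that] p_gt[OF that] that by (simp add: N_def)
      have N: "real i \<le> N" "0 < N"
        using p_gt[OF that] that by (simp_all add: N_def)
      have "1 - R \<le> (N - real (r i) + 1) / N"
        using r_le[OF that] N by (simp add: field_simps flip: N_def)
      moreover have "(N - real (r i) + 1) / N \<le> (N - N * R + 2) / N"
        using r_gt[OF that] N by (intro divide_right_mono) (simp_all flip: N_def)
      moreover have "(N - N * R + 2) / N = 1 - R + 2 / N"
        using N by (simp add: field_simps)
      moreover have "2 / N \<le> 2 / real i"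
        using N that by (intro divide_left_mono) auto
      ultimately show ?thesis
        unfolding d N_def[symmetric] by linarith
    qed
    show ?thesis
    proof (rule tendsto_sandwich)
      show "\<forall>\<^sub>F i in sequentially.
          1 - R \<le> real (min_distance (GF (p i)) (p i - 1) (C i)) / (real (p i) - 1)"
        using bounds by (auto intro: eventually_sequentiallyI[of 1])
      show "\<forall>\<^sub>F i in sequentially.
          real (min_distance (GF (p i)) (p i - 1) (C i)) / (real (p i) - 1) \<le> 1 - R + 2 / real i"
        using bounds by (auto intro: eventually_sequentiallyI[of 1])
      have "(\<lambda>i. 1 - R + 2 / real i) \<longlonglongrightarrow> 1 - R + 0"
        by (intro tendsto_intros lim_const_over_n)
      then show "(\<lambda>i. 1 - R + 2 / real i) \<longlonglongrightarrow> 1 - R"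
        by simp
    qed (rule tendsto_const)
  qed
  ultimately show ?thesis
    by (simp add: MDS_code_def)
qed

end
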